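(* Let $f=\sum_{1\le i\le j\le n}a_{ij}t_it_j\in\mathbb{Z}[t_1,\ldots,t_n]$ be an anisotropic quadratic form. Let $d\in\mathbb{Z}\setminus\{0\}$ be an odd integer coprime to $\operatorname{disc} f$ and such that the base change of $f$ to $\mathbb{Z}/d\mathbb{Z}$ is hyperbolic. Then there are $v\in\mathbb{Z}^n$ and $k\in\mathbb{Z}$ such that $$f(v)=kd,\qquad 0<|k|<|f|.$$
   Context: $|f|=\sum_{1\le i\le j\le n}|a_{ij}|$ is the sum of the absolute values of the coefficients of $f$. The form $f$ is anisotropic if $f(v)\neq0$ for all nonzero $v\in\mathbb{Z}^n$. $\operatorname{disc} f$ is the determinant of the matrix $(\partial^2f/\partial t_i\partial t_j)$. The base change of $f$ to $\mathbb{Z}/d\mathbb{Z}$ is hyperbolic if $n$ is even and it is isomorphic to $\bigoplus_{i=1}^{n/2}\mathbb{H}$, where $\mathbb{H}$ is the hyperbolic plane (the quadratic form $xy$ on a free module of rank $2$). *)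

theory Defs
  imports "Jordan_Normal_Form.Determinant" "HOL-Algebra.IntRing"
begin

text \<open>
  A quadratic form \<open>\<Sum> c\<^sub>i\<^sub>j t\<^sub>i t\<^sub>j\<close> (sum over \<open>i \<le> j\<close>) in \<open>n\<close> variables is given by its coefficients
  \<open>c\<close>. Variables are numbered from \<open>0\<close> to \<open>n - 1\<close>, and only the values \<open>c i j\<close> with \<open>i \<le> j < n\<close>
  are ever used.
\<close>

definition index_pairs :: "nat \<Rightarrow> (nat \<times> nat) set" where
  "index_pairs n = {(i, j). i \<le> j \<and> j < n}"

lemma finite_index_pairs [simp]: "finite (index_pairs n)"
  by (rule finite_subset[of _ "{..<n} \<times> {..<n}"]) (auto simp: index_pairs_def)

definition qform ::
    "('a, 'b) ring_scheme \<Rightarrow> nat \<Rightarrow> (nat \<Rightarrow> nat \<Rightarrow> 'a) \<Rightarrow> 'a vec \<Rightarrow> 'a" where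
  "qform R n c x = 
    finsum R (\<lambda>(i, j). c i j \<otimes>\<^bsub>R\<^esub> (x $ i \<otimes>\<^bsub>R\<^esub> x $ j)) (index_pairs n)"

lemma qform_int: "qform \<Z> n a v = (\<Sum>(i, j)\<in>index_pairs n. a i j * (v $ i * v $ j))"
  by (simp add: qform_def int_finsum_eq)

definition coeff_norm :: "nat \<Rightarrow> (nat \<Rightarrow> nat \<Rightarrow> int) \<Rightarrow> int" where
  "coeff_norm n a = (\<Sum>(i, j)\<in>index_pairs n. \<bar>a i j\<bar>)"

definition anisotropic :: "nat \<Rightarrow> (nat \<Rightarrow> nat \<Rightarrow> int) \<Rightarrow> bool" where
  "anisotropic n a \<longleftrightarrow> (\<forall>v\<in>carrier_vec n. v \<noteq> 0\<^sub>v n \<longrightarrow> qform \<Z> n a v \<noteq> 0)"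

text \<open>
  The (constant) second partial derivatives of the form; \<open>hessian_entry_derivative\<close> below
  confirms the values.
\<close>

definition hessian_entry :: "(nat \<Rightarrow> nat \<Rightarrow> int) \<Rightarrow> nat \<Rightarrow> nat \<Rightarrow> int" where
  "hessian_entry a i j = (if i = j then 2 * a i i else a (min i j) (max i j))"

lemma sum_index_pairs_hessian:
  fixes x :: "nat \<Rightarrow> real"
  assumes "j < n"
  shows "(\<Sum>(k, l)\<in>index_pairs n. of_int (a k l) *
            ((if k = j then x l else 0) + (if l = j then x k else 0)))
          = (\<Sum>k<n. of_int (hessian_entry a j k) * x k)"
proof -
  have split: "(\<Sum>(k, l)\<in>index_pairs n. g k l)
      = (\<Sum>k<n. \<Sum>l<n. if k \<le> l then g k l else 0)"
    for g :: "nat \<Rightarrow> nat \<Rightarrow> real"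
  proof -
    have "(\<Sum>k<n. \<Sum>l<n. if k \<le> l then g k l else 0)
        = (\<Sum>(k, l)\<in>{..<n} \<times> {..<n}. if k \<le> l then g k l else 0)"
      by (simp add: sum.cartesian_product)
    also have "\<dots> = (\<Sum>(k, l)\<in>index_pairs n. g k l)"
      by (rule sum.mono_neutral_cong_right) (auto simp: index_pairs_def split: if_splits)
    finally show ?thesis by simp
  qed
  have first: "(\<Sum>k<n. \<Sum>l<n. if k = j then (if k \<le> l then of_int (a k l) * x l else 0) else 0)
      = (\<Sum>l<n. if j \<le> l then of_int (a j l) * x l else 0)"
  proof -
    have "(\<Sum>k<n. \<Sum>l<n. if k = j then (if k \<le> l then of_int (a k l) * x l else 0) else 0)
        = (\<Sum>k<n. if k = j then (\<Sum>l<n. if k \<le> l then of_int (a k l) * x l else 0) else 0)"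
      by (intro sum.cong) auto
    then show ?thesis using assms by simp
  qed
  have second: "(\<Sum>k<n. \<Sum>l<n. if l = j then (if k \<le> l then of_int (a k l) * x k else 0) else 0)
      = (\<Sum>k<n. if k \<le> j then of_int (a k j) * x k else 0)"
    using assms by simp
  have "(\<Sum>(k, l)\<in>index_pairs n. of_int (a k l) *
            ((if k = j then x l else 0) + (if l = j then x k else 0)))
      = (\<Sum>k<n. \<Sum>l<n.
            (if k = j then (if k \<le> l then of_int (a k l) * x l else 0) else 0)
          + (if l = j then (if k \<le> l then of_int (a k l) * x k else 0) else 0))"
    unfolding split by (intro sum.cong) (auto simp: algebra_simps)
  also have "\<dots> = (\<Sum>l<n. (if j \<le> l then of_int (a j l) * x l else 0)
      + (if l \<le> j then of_int (a l j) * x l else 0))"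
    by (simp only: sum.distrib first second)
  also have "\<dots> = (\<Sum>k<n. of_int (hessian_entry a j k) * x k)"
    by (intro sum.cong) (auto simp: hessian_entry_def min_def max_def)
  finally show ?thesis .
qed

lemma hessian_entry_derivative:
  fixes n :: nat and a :: "nat \<Rightarrow> nat \<Rightarrow> int" and x :: "nat \<Rightarrow> real"
  defines "F \<equiv> \<lambda>y :: nat \<Rightarrow> real. \<Sum>(k, l)\<in>index_pairs n. of_int (a k l) * (y k * y l)"
  defines "F' \<equiv> \<lambda>j y. \<Sum>k<n. of_int (hessian_entry a j k) * y k"
  assumes "i < n" "j < n"
  shows "((\<lambda>s. F (x(j := s))) has_field_derivative F' j x) (at (x j))"
    and "((\<lambda>s. F' j (x(i := s))) has_field_derivative of_int (hessian_entry a i j)) (at (x i))"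
proof -
  have upd: "((\<lambda>s. (x(m := s)) k) has_field_derivative (if k = m then 1 else 0)) (at t)"
    for m k t by (cases "k = m") auto
  have "((\<lambda>s. F (x(j := s))) has_field_derivative
      (\<Sum>p\<in>index_pairs n. of_int (a (fst p) (snd p)) *
        ((if fst p = j then 1 else 0) * (x(j := x j)) (snd p)
          + (if snd p = j then 1 else 0) * (x(j := x j)) (fst p)))) (at (x j))"
    unfolding F_def case_prod_beta
    by (intro DERIV_sum DERIV_cmult DERIV_mult upd)
  also have "(\<Sum>p\<in>index_pairs n. of_int (a (fst p) (snd p)) *
        ((if fst p = j then 1 else 0) * (x(j := x j)) (snd p)
          + (if snd p = j then 1 else 0) * (x(j := x j)) (fst p))) = F' j x"
    unfolding F'_def sum_index_pairs_hessian[OF \<open>j < n\<close>, symmetric]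
    by (intro sum.cong) auto
  finally show "((\<lambda>s. F (x(j := s))) has_field_derivative F' j x) (at (x j))" .
  have "((\<lambda>s. F' j (x(i := s))) has_field_derivative
      (\<Sum>k<n. of_int (hessian_entry a j k) * (if k = i then 1 else 0))) (at (x i))"
    unfolding F'_def by (intro DERIV_sum DERIV_cmult upd)
  also have "(\<Sum>k<n. of_int (hessian_entry a j k) * (if k = i then 1 else 0))
      = (\<Sum>k<n. if k = i then of_int (hessian_entry a j k) else (0 :: real))"
    by (intro sum.cong) auto
  also have "\<dots> = of_int (hessian_entry a i j)"
    using \<open>i < n\<close> by (simp add: hessian_entry_def min.commute max.commute)
  finally show "((\<lambda>s. F' j (x(i := s))) has_field_derivative of_int (hessian_entry a i j)) (at (x i))" .
qed

definition disc :: "nat \<Rightarrow> (nat \<Rightarrow> nat \<Rightarrow> int) \<Rightarrow> int" where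
  "disc n a = Determinant.det (mat n n (\<lambda>(i, j). hessian_entry a i j))"

text \<open>
  The free module \<open>R\<^sup>n\<close>. The library operations on vectors use type-class arithmetic on the entries,
  so addition and scalar multiplication are defined here from the ring structure \<open>R\<close>.
\<close>

definition free_mod :: "('a, 'b) ring_scheme \<Rightarrow> nat \<Rightarrow> 'a vec set" where
  "free_mod R n = {x \<in> carrier_vec n. \<forall>i<n. x $ i \<in> carrier R}"

definition free_mod_add ::
    "('a, 'b) ring_scheme \<Rightarrow> nat \<Rightarrow> 'a vec \<Rightarrow> 'a vec \<Rightarrow> 'a vec" where
  "free_mod_add R n x y = vec n (\<lambda>i. x $ i \<oplus>\<^bsub>R\<^esub> y $ i)"

definition free_mod_smult ::
    "('a, 'b) ring_scheme \<Rightarrow> nat \<Rightarrow> 'a \<Rightarrow> 'a vec \<Rightarrow> 'a vec" where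
  "free_mod_smult R n r x = vec n (\<lambda>i. r \<otimes>\<^bsub>R\<^esub> x $ i)"

definition qform_isomorphic ::
    "('a, 'b) ring_scheme \<Rightarrow> nat \<Rightarrow> ('a vec \<Rightarrow> 'a) \<Rightarrow> ('a vec \<Rightarrow> 'a) \<Rightarrow> bool" where
  "qform_isomorphic R n q q' \<longleftrightarrow>
    (\<exists>\<phi>. bij_betw \<phi> (free_mod R n) (free_mod R n)
       \<and> (\<forall>x\<in>free_mod R n. \<forall>y\<in>free_mod R n.
             \<phi> (free_mod_add R n x y) = free_mod_add R n (\<phi> x) (\<phi> y))
       \<and> (\<forall>r\<in>carrier R. \<forall>x\<in>free_mod R n.
             \<phi> (free_mod_smult R n r x) = free_mod_smult R n r (\<phi> x))
       \<and> (\<forall>x\<in>free_mod R n. q' (\<phi> x) = q x))"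

text \<open>
  The orthogonal sum of \<open>m\<close> hyperbolic planes on \<open>R\<^sup>2\<^sup>m\<close>; the coordinates \<open>2 i\<close> and \<open>2 i + 1\<close> are
  those of the \<open>i\<close>-th plane.
\<close>

definition hyperbolic_sum :: "('a, 'b) ring_scheme \<Rightarrow> nat \<Rightarrow> 'a vec \<Rightarrow> 'a" where
  "hyperbolic_sum R m x = (\<Oplus>\<^bsub>R\<^esub>i\<in>{..<m}. x $ (2 * i) \<otimes>\<^bsub>R\<^esub> x $ (2 * i + 1))"

definition hyperbolic ::
    "('a, 'b) ring_scheme \<Rightarrow> nat \<Rightarrow> (nat \<Rightarrow> nat \<Rightarrow> 'a) \<Rightarrow> bool" where
  "hyperbolic R n c \<longleftrightarrow>
    even n \<and> qform_isomorphic R n (qform R n c) (hyperbolic_sum R (n div 2))"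

text \<open>
  Coefficients of the base change along \<open>\<int> \<rightarrow> \<int>/d\<int>\<close>: \<open>ZFact d\<close> is the quotient ring, and
  \<open>ZMod d a\<close> is the class of \<open>a\<close> in it. For \<open>d = \<plusminus>1\<close> this is the zero ring.
\<close>

definition base_change :: "int \<Rightarrow> (nat \<Rightarrow> nat \<Rightarrow> int) \<Rightarrow> nat \<Rightarrow> nat \<Rightarrow> int set" where
  "base_change d a i j = ZMod d (a i j)"

end

theory Submission
  imports Defs
begin

text \<open>
  Write \<open>D = |d|\<close> and \<open>n = 2 m\<close>. A hyperbolic form over \<open>\<int>/d\<int>\<close> vanishes on the submodule where the
  first coordinate of each hyperbolic plane is zero, and this submodule has index \<open>D\<^sup>m\<close>, the square
  root of the number \<open>D\<^sup>2\<^sup>m\<close> of all vectors. Its preimage in \<open>\<int>\<^sup>n\<close> is a lattice \<open>L\<close> of index at most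
  \<open>D\<^sup>m\<close> on which \<open>d\<close> divides \<open>f\<close>. By the pigeonhole principle a box of more than \<open>D\<^sup>m\<close> integer points
  contains two points that differ by an element \<open>v \<noteq> 0\<close> of \<open>L\<close>
  (\<open>small_isotropic_vector_mod\<close>), and a box with sides about \<open>\<surd>D\<close> is large enough. So
  \<open>|v\<^sub>i v\<^sub>j| \<le> D\<close> for all \<open>i, j\<close>, whence \<open>|f(v)| \<le> |f| D\<close>; and \<open>f(v) \<noteq> 0\<close> because \<open>f\<close> is anisotropic.

  The strict inequality needs care if \<open>D = s\<^sup>2\<close> is a square: then the entries of \<open>v\<close> may all be \<open>\<plusminus>s\<close>
  if the box is a cube. The remedy is to shorten one side of the box. With first side \<open>s\<close> instead
  of \<open>s + 1\<close> the box still has \<open>s (s + 1)\<^bsup>n-1\<^esup> > s\<^sup>n = D\<^sup>m\<close> points, but now \<open>|v\<^sub>0| < s\<close>, and the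
  coefficient of \<open>t\<^sub>0\<^sup>2\<close>, which is nonzero by anisotropy, makes the estimate of \<open>|f(v)|\<close> strict
  (\<open>abs_qform_less\<close>).
\<close>

section \<open>The estimate for the values of the form\<close>

lemma abs_qform_less:
  fixes a :: "nat \<Rightarrow> nat \<Rightarrow> int" and v :: "int vec"
  assumes "0 < n" and "a 0 0 \<noteq> 0"
    and le: "\<And>i. i < n \<Longrightarrow> \<bar>v $ i\<bar>\<^sup>2 \<le> D"
    and less: "\<bar>v $ 0\<bar>\<^sup>2 < D"
  shows "\<bar>qform \<Z> n a v\<bar> < coeff_norm n a * D"
proof -
  have prod_le: "\<bar>v $ i\<bar> * \<bar>v $ j\<bar> \<le> D" if "i < n" "j < n" for i j
  proof (cases "\<bar>v $ i\<bar> \<le> \<bar>v $ j\<bar>")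
    case True
    then have "\<bar>v $ i\<bar> * \<bar>v $ j\<bar> \<le> \<bar>v $ j\<bar>\<^sup>2"
      by (simp add: power2_eq_square mult_right_mono del: abs_mult_self_eq)
    with le[OF \<open>j < n\<close>] show ?thesis by linarith
  next
    case False
    then have "\<bar>v $ i\<bar> * \<bar>v $ j\<bar> \<le> \<bar>v $ i\<bar>\<^sup>2"
      by (simp add: power2_eq_square mult_left_mono del: abs_mult_self_eq)
    with le[OF \<open>i < n\<close>] show ?thesis by linarith
  qed
  have "\<bar>qform \<Z> n a v\<bar> \<le> (\<Sum>p\<in>index_pairs n. \<bar>a (fst p) (snd p) * (v $ fst p * v $ snd p)\<bar>)"
    unfolding qform_int case_prod_beta by (rule sum_abs)
  also have "\<dots> < (\<Sum>p\<in>index_pairs n. \<bar>a (fst p) (snd p)\<bar> * D)"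
  proof (rule sum_strict_mono_ex1)
    show "\<forall>p\<in>index_pairs n. \<bar>a (fst p) (snd p) * (v $ fst p * v $ snd p)\<bar> \<le> \<bar>a (fst p) (snd p)\<bar> * D"
      using prod_le by (auto simp: index_pairs_def abs_mult intro!: mult_left_mono)
    have "\<bar>a 0 0 * (v $ 0 * v $ 0)\<bar> < \<bar>a 0 0\<bar> * D"
      using less \<open>a 0 0 \<noteq> 0\<close> by (simp add: abs_mult power2_eq_square)
    then show "\<exists>p\<in>index_pairs n.
        \<bar>a (fst p) (snd p) * (v $ fst p * v $ snd p)\<bar> < \<bar>a (fst p) (snd p)\<bar> * D"
      using \<open>0 < n\<close> by (intro bexI[of _ "(0, 0)"]) (auto simp: index_pairs_def)
  qed simp
  also have "\<dots> = coeff_norm n a * D"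
    by (simp add: coeff_norm_def case_prod_beta sum_distrib_right)
  finally show ?thesis .
qed

lemma anisotropic_diagonal_nonzero:
  assumes "anisotropic n a" and "i < n"
  shows "a i i \<noteq> 0"
proof -
  have "qform \<Z> n a (unit_vec n i)
      = (\<Sum>p\<in>index_pairs n. if p = (i, i) then a i i else 0)"
    unfolding qform_int
    by (intro sum.cong) (auto simp: index_pairs_def unit_vec_def)
  also have "\<dots> = a i i"
    using \<open>i < n\<close> by (subst sum.delta[OF finite_index_pairs]) (simp add: index_pairs_def)
  finally have "qform \<Z> n a (unit_vec n i) = a i i" .
  moreover have "qform \<Z> n a (unit_vec n i) \<noteq> 0"
    using assms by (simp add: anisotropic_def)
  ultimately show ?thesis by simp
qed

section \<open>Reduction modulo \<open>d\<close>\<close>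

lemma ZMod_hom: "ring_hom_cring \<Z> (ZFact d) (ZMod d)"
proof -
  have "ideal (Idl\<^bsub>\<Z>\<^esub> {d}) \<Z>"
    by (simp add: int.genideal_ideal)
  then have "ring_hom_cring \<Z> (ZFact d) ((+>\<^bsub>\<Z>\<^esub>) (Idl\<^bsub>\<Z>\<^esub> {d}))"
    unfolding ZFact_def by (rule ideal.rcos_ring_hom_cring) (rule int_is_cring)
  moreover have "ZMod d = (+>\<^bsub>\<Z>\<^esub>) (Idl\<^bsub>\<Z>\<^esub> {d})"
    by (rule ext) (simp add: ZMod_def)
  ultimately show ?thesis by simp
qed

lemma carrier_ZFact_subset:
  assumes "d \<noteq> 0"
  shows "carrier (ZFact d) \<subseteq> ZMod d ` {0..<\<bar>d\<bar>}"
proof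
  fix X assume "X \<in> carrier (ZFact d)"
  then obtain k where "X = ZMod d k"
    by (auto simp: ZFact_defs A_RCOSETS_def' ZMod_def)
  moreover have "k mod \<bar>d\<bar> mod d = k mod d"
    by (rule mod_mod_cancel) simp
  ultimately have "X = ZMod d (k mod \<bar>d\<bar>)"
    by (simp add: ZMod_eq_mod)
  then show "X \<in> ZMod d ` {0..<\<bar>d\<bar>}"
    using \<open>d \<noteq> 0\<close> by simp
qed

lemma
  assumes "d \<noteq> 0"
  shows finite_carrier_ZFact: "finite (carrier (ZFact d))"
    and card_carrier_ZFact_le: "card (carrier (ZFact d)) \<le> nat \<bar>d\<bar>"
proof -
  show "finite (carrier (ZFact d))"
    using carrier_ZFact_subset[OF assms] by (rule finite_subset) simp
  have "card (carrier (ZFact d)) \<le> card (ZMod d ` {0..<\<bar>d\<bar>})"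
    using carrier_ZFact_subset[OF assms] by (intro card_mono) auto
  also have "\<dots> \<le> card {0..<\<bar>d\<bar>}"
    by (rule card_image_le) simp
  finally show "card (carrier (ZFact d)) \<le> nat \<bar>d\<bar>"
    by simp
qed

lemma qform_base_change:
  assumes "v \<in> carrier_vec n"
  shows "qform (ZFact d) n (base_change d a) (map_vec (ZMod d) v) = ZMod d (qform \<Z> n a v)"
proof -
  interpret ring_hom_cring \<Z> "ZFact d" "ZMod d"
    by (rule ZMod_hom)
  have mult: "ZMod d (x * y) = ZMod d x \<otimes>\<^bsub>ZFact d\<^esub> ZMod d y" for x y
    using hom_mult[of x y] by simp
  have closed: "ZMod d x \<in> carrier (ZFact d)" for x
    using hom_closed[of x] by simp
  have "ZMod d (qform \<Z> n a v)
      = finsum (ZFact d) (ZMod d \<circ> (\<lambda>(i, j). a i j \<otimes>\<^bsub>\<Z>\<^esub> (v $ i \<otimes>\<^bsub>\<Z>\<^esub> v $ j))) (index_pairs n)"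
    unfolding qform_def by (rule ring_hom_cring.hom_finsum[OF ZMod_hom]) simp
  also have "\<dots> = qform (ZFact d) n (base_change d a) (map_vec (ZMod d) v)"
    unfolding qform_def
    using assms
    by (intro S.finsum_cong') (auto simp: index_pairs_def base_change_def mult closed)
  finally show ?thesis by simp
qed

lemma ZMod_eq_zero_iff: "ZMod d k = \<zero>\<^bsub>ZFact d\<^esub> \<longleftrightarrow> d dvd k"
proof -
  interpret ring_hom_cring \<Z> "ZFact d" "ZMod d"
    by (rule ZMod_hom)
  have zero: "\<zero>\<^bsub>ZFact d\<^esub> = ZMod d 0"
    using hom_zero by simp
  show ?thesis
    by (simp only: zero ZMod_eq_mod dvd_eq_mod_eq_0 mod_0)
qed

section \<open>A short vector on which the form vanishes modulo \<open>d\<close>\<close>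

text \<open>
  A box with first side \<open>p\<close> and all others \<open>q\<close> will be used: the lower bounds on \<open>p q\<close> and \<open>q\<^sup>2\<close> give
  it more than \<open>D\<^bsup>n/2\<^esup>\<close> points, and the upper bounds on \<open>p - 1\<close> and \<open>q - 1\<close> limit the differences
  of its points, strictly in the first coordinate. For \<open>D = s\<^sup>2\<close> the sides are \<open>p = s\<close> and \<open>q = s + 1\<close>, otherwise both are \<open>s + 1\<close> with
  \<open>s = \<lfloor>\<surd>D\<rfloor>\<close>.
\<close>

lemma box_sides:
  fixes D :: nat
  assumes "0 < D"
  obtains p q :: nat where "0 < p" "0 < q" "D < p * q" "D \<le> q\<^sup>2" "(p - 1)\<^sup>2 < D" "(q - 1)\<^sup>2 \<le> D"
proof -
  define s where "s = Max {s. s\<^sup>2 \<le> D}"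
  have "s \<le> D" if "s\<^sup>2 \<le> D" for s
    using that power2_nat_le_imp_le by blast
  then have fin: "finite {s. s\<^sup>2 \<le> D}"
    by (intro finite_subset[OF _ finite_atMost[of D]]) auto
  have "s \<in> {s. s\<^sup>2 \<le> D}"
    unfolding s_def using fin by (rule Max_in) (auto intro: exI[of _ 0])
  then have s_le: "s\<^sup>2 \<le> D" by simp
  have less_s: "D < (s + 1)\<^sup>2"
  proof (rule ccontr)
    assume "\<not> D < (s + 1)\<^sup>2"
    then have "s + 1 \<le> s"
      unfolding s_def using fin by (intro Max_ge) auto
    then show False by simp
  qed
  show ?thesis
  proof (cases "s\<^sup>2 = D")
    case True
    with \<open>0 < D\<close> have "0 < s" by (cases s) auto
    have "(s - 1)\<^sup>2 < s\<^sup>2"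
      using \<open>0 < s\<close> by (intro power_strict_mono) auto
    with True \<open>0 < s\<close> less_s show ?thesis
      by (intro that[of s "s + 1"]) (auto simp: power2_eq_square)
  next
    case False
    with s_le less_s show ?thesis
      by (intro that[of "s + 1" "s + 1"]) (auto simp: power2_eq_square)
  qed
qed

text \<open>
  Two points of the box on which the \<open>n div 2\<close> coordinates with even index, taken after the
  isometry to the hyperbolic sum, agree have a difference on which these coordinates vanish; each
  product in the hyperbolic sum contains one of them.
\<close>

lemma small_isotropic_vector_mod:
  fixes b :: "nat \<Rightarrow> nat"
  assumes "d \<noteq> 0"
    and hyp: "hyperbolic (ZFact d) n (base_change d a)"
    and large: "nat \<bar>d\<bar> ^ (n div 2) < (\<Prod>i<n. b i)"
  shows "\<exists>v\<in>carrier_vec n. v \<noteq> 0\<^sub>v n \<and> (\<forall>i<n. \<bar>v $ i\<bar> < int (b i)) \<and> d dvd qform \<Z> n a v"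
proof -
  interpret ring_hom_cring \<Z> "ZFact d" "ZMod d"
    by (rule ZMod_hom)
  define m where "m = n div 2"
  obtain \<phi> where bij: "bij_betw \<phi> (free_mod (ZFact d) n) (free_mod (ZFact d) n)"
    and add: "\<And>x y. x \<in> free_mod (ZFact d) n \<Longrightarrow> y \<in> free_mod (ZFact d) n \<Longrightarrow>
      \<phi> (free_mod_add (ZFact d) n x y) = free_mod_add (ZFact d) n (\<phi> x) (\<phi> y)"
    and isometry: "\<And>x. x \<in> free_mod (ZFact d) n \<Longrightarrow>
      hyperbolic_sum (ZFact d) m (\<phi> x) = qform (ZFact d) n (base_change d a) x"
    using hyp unfolding hyperbolic_def qform_isomorphic_def m_def by blast
  have reduce: "map_vec (ZMod d) v \<in> free_mod (ZFact d) n" if "v \<in> carrier_vec n" for v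
    using that hom_closed by (auto simp: free_mod_def)
  have image: "\<phi> (map_vec (ZMod d) v) \<in> free_mod (ZFact d) n" if "v \<in> carrier_vec n" for v
    using bij reduce[OF that] by (auto simp: bij_betw_def)
  have even_less: "2 * i < n" "2 * i + 1 < n" if "i < m" for i
    using that by (auto simp: m_def)
  have coord: "\<phi> (map_vec (ZMod d) v) $ i \<in> carrier (ZFact d)"
    if "v \<in> carrier_vec n" "i < n" for v i
    using image[OF that(1)] that(2) by (simp add: free_mod_def)

  define box where "box = PiE {..<n} (\<lambda>i. {0..<int (b i)})"
  define F where "F = (\<lambda>g. \<lambda>i\<in>{..<m}. \<phi> (map_vec (ZMod d) (vec n g)) $ (2 * i))"
  let ?target = "PiE {..<m} (\<lambda>_. carrier (ZFact d))"
  have "F ` box \<subseteq> ?target"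
    by (auto simp: F_def intro!: coord even_less)
  moreover have "finite ?target"
    using finite_carrier_ZFact[OF \<open>d \<noteq> 0\<close>] by (intro finite_PiE) auto
  ultimately have "card (F ` box) \<le> card ?target"
    by (intro card_mono)
  also have "\<dots> = card (carrier (ZFact d)) ^ m"
    by (simp add: card_PiE)
  also have "\<dots> \<le> nat \<bar>d\<bar> ^ m"
    using card_carrier_ZFact_le[OF \<open>d \<noteq> 0\<close>] by (rule power_mono) simp
  also have "\<dots> < card box"
    using large by (simp add: box_def card_PiE m_def)
  finally have "\<not> inj_on F box"
    by (rule pigeonhole)
  then obtain g h where gh: "g \<in> box" "h \<in> box" "g \<noteq> h" "F g = F h"
    by (auto simp: inj_on_def)

  define v where "v = vec n g - vec n h"
  have v: "v \<in> carrier_vec n"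
    by (simp add: v_def)
  have "\<exists>i<n. g i \<noteq> h i"
    using gh(1-3) unfolding box_def by (metis PiE_ext lessThan_iff)
  then have "v \<noteq> 0\<^sub>v n"
    by (auto simp: v_def vec_eq_iff)
  moreover have "\<bar>v $ i\<bar> < int (b i)" if "i < n" for i
  proof -
    have "g i \<in> {0..<int (b i)}" "h i \<in> {0..<int (b i)}"
      using gh(1,2) that by (auto simp: box_def PiE_iff)
    then show ?thesis
      using that by (auto simp: v_def)
  qed
  moreover have "d dvd qform \<Z> n a v"
  proof -
    have vanish: "\<phi> (map_vec (ZMod d) v) $ (2 * i) = \<zero>\<^bsub>ZFact d\<^esub>" if "i < m" for i
    proof -
      let ?x = "\<phi> (map_vec (ZMod d) v) $ (2 * i)"
      let ?y = "\<phi> (map_vec (ZMod d) (vec n h)) $ (2 * i)"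
      have ZMod_add: "ZMod d (x + y) = ZMod d x \<oplus>\<^bsub>ZFact d\<^esub> ZMod d y" for x y
        using hom_add[of x y] by simp
      have "map_vec (ZMod d) (vec n g)
          = free_mod_add (ZFact d) n (map_vec (ZMod d) v) (map_vec (ZMod d) (vec n h))"
        by (rule eq_vecI) (auto simp: free_mod_add_def v_def ZMod_add[symmetric])
      then have "\<phi> (map_vec (ZMod d) (vec n g)) $ (2 * i) = ?x \<oplus>\<^bsub>ZFact d\<^esub> ?y"
        using even_less[OF that] add[OF reduce[OF v] reduce[of "vec n h"]]
        by (simp add: free_mod_add_def)
      moreover have "\<phi> (map_vec (ZMod d) (vec n g)) $ (2 * i) = ?y"
        using fun_cong[OF gh(4), of i] that by (simp add: F_def)
      moreover have "?x \<in> carrier (ZFact d)" "?y \<in> carrier (ZFact d)"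
        using even_less[OF that] v by (auto intro!: coord)
      ultimately show ?thesis
        by (metis S.add.r_cancel_one)
    qed
    have "ZMod d (qform \<Z> n a v) = hyperbolic_sum (ZFact d) m (\<phi> (map_vec (ZMod d) v))"
      using isometry[OF reduce[OF v]] qform_base_change[OF v] by simp
    also have "\<dots> = finsum (ZFact d) (\<lambda>_. \<zero>\<^bsub>ZFact d\<^esub>) {..<m}"
      unfolding hyperbolic_sum_def
    proof (rule S.finsum_cong')
      fix i assume "i \<in> {..<m}"
      then show "\<phi> (map_vec (ZMod d) v) $ (2 * i) \<otimes>\<^bsub>ZFact d\<^esub> \<phi> (map_vec (ZMod d) v) $ (2 * i + 1)
          = \<zero>\<^bsub>ZFact d\<^esub>"
        using vanish coord[OF v] even_less by simp
    qed auto
    also have "\<dots> = \<zero>\<^bsub>ZFact d\<^esub>"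
      by simp
    finally show ?thesis
      by (simp add: ZMod_eq_zero_iff)
  qed
  ultimately show ?thesis
    using v by blast
qed

section \<open>Existence of a small multiple of \<open>d\<close> among the values\<close>

theorem theorem7p3:
  fixes n :: nat and a :: "nat \<Rightarrow> nat \<Rightarrow> int" and d :: int
  assumes "n \<ge> 1"
    and "anisotropic n a"
    and "d \<noteq> 0"
    and "odd d"
    and "coprime d (disc n a)"
    and "hyperbolic (ZFact d) n (base_change d a)"
  shows "\<exists>v\<in>carrier_vec n. \<exists>k. qform \<Z> n a v = k * d \<and> 0 < \<bar>k\<bar> \<and> \<bar>k\<bar> < coeff_norm n a"
proof -
  define D where "D = nat \<bar>d\<bar>"
  have "0 < D" and int_D: "int D = \<bar>d\<bar>"
    using \<open>d \<noteq> 0\<close> by (auto simp: D_def)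
  obtain p q :: nat where pq: "0 < p" "0 < q" "D < p * q" "D \<le> q\<^sup>2" "(p - 1)\<^sup>2 < D" "(q - 1)\<^sup>2 \<le> D"
    using box_sides[OF \<open>0 < D\<close>] .
  define b where "b = (\<lambda>i::nat. if i = 0 then p else q)"

  have "even n"
    using assms(6) by (simp add: hyperbolic_def)
  then obtain m where "n = 2 * m" ..
  moreover from this \<open>n \<ge> 1\<close> obtain l where "m = Suc l"
    by (cases m) auto
  ultimately have n: "n = Suc (Suc (2 * l))" by simp
  have "n div 2 = Suc l"
    by (simp add: n)
  then have power_eq: "nat \<bar>d\<bar> ^ (n div 2) = D * D ^ l"
    by (simp only: D_def power_Suc)
  have "(\<Prod>i<n. b i) = p * q ^ Suc (2 * l)"
    unfolding n prod.lessThan_Suc_shift by (simp add: b_def)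
  also have "\<dots> = (p * q) * (q\<^sup>2) ^ l"
    by (simp add: power_mult)
  also have "\<dots> > D * D ^ l"
    using pq \<open>0 < D\<close> by (intro mult_less_le_imp_less power_mono) auto
  finally have "nat \<bar>d\<bar> ^ (n div 2) < (\<Prod>i<n. b i)"
    unfolding power_eq .
  then obtain v where v: "v \<in> carrier_vec n" "v \<noteq> 0\<^sub>v n"
    and small: "\<And>i. i < n \<Longrightarrow> \<bar>v $ i\<bar> < int (b i)"
    and "d dvd qform \<Z> n a v"
    using small_isotropic_vector_mod[OF \<open>d \<noteq> 0\<close> assms(6)] by blast
  then obtain k where k: "qform \<Z> n a v = k * d"
    by (metis dvdE mult.commute)

  have square_le: "\<bar>v $ i\<bar>\<^sup>2 \<le> int ((b i - 1)\<^sup>2)" if "i < n" for i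
  proof -
    have "\<bar>v $ i\<bar> \<le> int (b i - 1)"
      using small[OF that] by simp
    then have "\<bar>v $ i\<bar>\<^sup>2 \<le> (int (b i - 1))\<^sup>2"
      by (rule power_mono) simp
    then show ?thesis by simp
  qed
  have "\<bar>qform \<Z> n a v\<bar> < coeff_norm n a * int D"
  proof (rule abs_qform_less)
    show "0 < n" "a 0 0 \<noteq> 0"
      using \<open>n \<ge> 1\<close> anisotropic_diagonal_nonzero[OF assms(2), of 0] by auto
    show "\<bar>v $ i\<bar>\<^sup>2 \<le> int D" if "i < n" for i
    proof -
      have "(b i - 1)\<^sup>2 \<le> D"
        using pq(5,6) by (simp add: b_def)
      with square_le[OF that] show ?thesis by linarith
    qed
    have "(b 0 - 1)\<^sup>2 < D"
      using pq(5) by (simp add: b_def)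
    with square_le[of 0] \<open>n \<ge> 1\<close> show "\<bar>v $ 0\<bar>\<^sup>2 < int D" by linarith
  qed
  then have "\<bar>k\<bar> < coeff_norm n a"
    using \<open>d \<noteq> 0\<close> by (simp add: k abs_mult int_D)
  moreover have "k \<noteq> 0"
    using assms(2) v k by (auto simp: anisotropic_def)
  ultimately show ?thesis
    using v(1) k by auto
qed

end
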